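(* Let $A$ be the adjacency matrix of a graph drawn from the Watts–Strogatz model ${\sf WS}(n,k,\beta)$ with hidden permutation $\pi$, where $k=k(n)\to\infty$ as $n\to\infty$ and $\beta=\beta(n)$. For each node $v_i$, let $\mathcal{N}(v_i)$ be its true ring neighborhood and let $\hat{\mathcal{N}}(v_i)$ be the output of the correlation thresholding procedure (both defined in the context). If $$1-\beta\ \succ\ \sqrt{\frac{\log n}{k}}\vee\left(\frac{\log n}{n}\right)^{1/4},$$ then correlation thresholding provides a consistent estimate of the neighborhood sets with high probability, in the sense that $$\lim_{n,k(n)\to\infty}\ \max_{i}\ \frac{|\hat{\mathcal{N}}(v_i)\,\triangle\,\mathcal{N}(v_i)|}{|\mathcal{N}(v_i)|}=0,$$ where the maximum is over all $n$ nodes and $\triangle$ denotes symmetric set difference; that is, there is a deterministic sequence $\varepsilon_n\to0$ such that, with probability tending to $1$, this maximum is at most $\varepsilon_n$.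
   Context: Parameters: $n$ is the number of nodes, $k$ (even) the neighborhood size, $\beta\in[0,1]$ the rewiring probability. Ring lattice matrix: $B\in\{0,1\}^{n\times n}$ is given by $B_{ij}=1$ if $i\ne j$ and the ring (circular) distance $\min(|i-j|,n-|i-j|)$ is at most $k/2$, and $B_{ij}=0$ otherwise. For a permutation $\pi$ of the $n$ nodes with permutation matrix $P_\pi$, the convention is $[P_\pi B P_\pi^T]_{ij}=B_{\pi^{-1}(i)\pi^{-1}(j)}$. ${\sf WS}(n,k,\beta)$ with hidden permutation $\pi$: the symmetric random adjacency matrix $A\in\{0,1\}^{n\times n}$ with zero diagonal whose entries $A_{ij}$, $i<j$, are independent, with $A_{ij}\sim{\sf Bernoulli}\left(1-\beta(1-\beta\frac{k}{n-1})\right)$ if $[P_\pi BP_\pi^T]_{ij}=1$ and $A_{ij}\sim{\sf Bernoulli}\left(\beta\frac{k}{n-1}\right)$ if $[P_\pi BP_\pi^T]_{ij}=0$. True neighborhood: $\mathcal{N}(v_i)$ is the set of nodes $v_j$ such that $j\ne i$ and the ring distance between $\pi^{-1}(i)$ and $\pi^{-1}(j)$ is at most $k/2$. Correlation thresholding: for each node $v_i$, compute the inner products $\langle A_i,A_j\rangle$ of the rows $A_i,A_j$ of $A$ for all $j\ne i$, sort them in decreasing order, and let $\hat{\mathcal{N}}(v_i)$ be the set of the $k$ nodes $v_j$ with the largest values (ties broken arbitrarily). Notation: $a\vee b=\max(a,b)$; $a(n)\succ b(n)$ means $\limsup_{n\to\infty}b(n)/a(n)=0$.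
   Formalization: The formal theorem additionally assumes 3k ≤ 2n for all large n; without it the claim fails, e.g. for β = 0 and k/n tending to a limit strictly between 2/3 and 1, where non-neighbors share more common neighbors with a node than many of its true neighbors do. *)

theory Defs
  imports "HOL-Probability.Probability"
begin

text \<open>
  The nodes are \<open>0, \<dots>, n - 1\<close>. An \<open>n \<times> n\<close> matrix is a function
  \<^typ>\<open>nat \<Rightarrow> nat \<Rightarrow> real\<close>, of which only the entries with both indices below \<open>n\<close> matter.
\<close>

type_synonym matrix = "nat \<Rightarrow> nat \<Rightarrow> real"

text \<open>
  \<open>a \<succ> b\<close>. Since division by zero yields 0 in HOL, it has to be said separately that the
  quotient is defined for large \<open>n\<close>.
\<close>

definition dominates :: "(nat \<Rightarrow> real) \<Rightarrow> (nat \<Rightarrow> real) \<Rightarrow> bool" where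
  "dominates a b \<longleftrightarrow>
     (\<forall>\<^sub>F n in sequentially. a n \<noteq> 0) \<and> limsup (\<lambda>n. ereal (b n / a n)) = 0"

definition ring_dist :: "nat \<Rightarrow> nat \<Rightarrow> nat \<Rightarrow> int" where
  "ring_dist n i j = min \<bar>int i - int j\<bar> (int n - \<bar>int i - int j\<bar>)"

definition ring_lattice :: "nat \<Rightarrow> nat \<Rightarrow> matrix" where
  "ring_lattice n k i j =
     (if i \<noteq> j \<and> real_of_int (ring_dist n i j) \<le> real k / 2 then 1 else 0)"

text \<open>The matrix \<open>P\<^sub>\<pi> B P\<^sub>\<pi>\<^sup>T\<close>.\<close>

definition conj_perm :: "(nat \<Rightarrow> nat) \<Rightarrow> matrix \<Rightarrow> matrix" where
  "conj_perm \<pi> B i j = B (inv \<pi> i) (inv \<pi> j)"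

definition ws_edge_prob :: "nat \<Rightarrow> nat \<Rightarrow> real \<Rightarrow> (nat \<Rightarrow> nat) \<Rightarrow> nat \<Rightarrow> nat \<Rightarrow> real" where
  "ws_edge_prob n k \<beta> \<pi> i j =
     (if conj_perm \<pi> (ring_lattice n k) i j = 1
      then 1 - \<beta> * (1 - \<beta> * (real k / (real n - 1)))
      else \<beta> * (real k / (real n - 1)))"

text \<open>
  The distribution of the adjacency matrix: the entries above the diagonal are independent
  Bernoulli variables, and the matrix is completed by symmetry. For even \<open>k < n\<close> and
  \<open>\<beta> \<in> [0, 1]\<close> the edge probabilities lie in \<open>[0, 1]\<close>, so that \<^const>\<open>bernoulli_pmf\<close>
  does not truncate them.
\<close>

definition watts_strogatz :: "nat \<Rightarrow> nat \<Rightarrow> real \<Rightarrow> (nat \<Rightarrow> nat) \<Rightarrow> matrix pmf" where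
  "watts_strogatz n k \<beta> \<pi> =
     map_pmf (\<lambda>e i j. if i < n \<and> j < n \<and> i \<noteq> j \<and> e (min i j, max i j) then 1 else 0)
       (Pi_pmf {(i, j). i < j \<and> j < n} False
          (\<lambda>(i, j). bernoulli_pmf (ws_edge_prob n k \<beta> \<pi> i j)))"

definition true_nbhd :: "nat \<Rightarrow> nat \<Rightarrow> (nat \<Rightarrow> nat) \<Rightarrow> nat \<Rightarrow> nat set" where
  "true_nbhd n k \<pi> i =
     {j. j < n \<and> j \<noteq> i \<and> real_of_int (ring_dist n (inv \<pi> i) (inv \<pi> j)) \<le> real k / 2}"

definition row_inner :: "nat \<Rightarrow> matrix \<Rightarrow> nat \<Rightarrow> nat \<Rightarrow> real" where
  "row_inner n A i j = (\<Sum>l<n. A i l * A j l)"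

text \<open>
  \<open>S\<close> is a possible output of correlation thresholding at node \<open>i\<close>: the first \<open>k\<close> entries of
  some list of the other nodes in which the inner products decrease. The choice among these lists
  is the choice of how ties are broken.
\<close>

definition corr_thresholding ::
    "nat \<Rightarrow> nat \<Rightarrow> matrix \<Rightarrow> nat \<Rightarrow> nat set \<Rightarrow> bool" where
  "corr_thresholding n k A i S \<longleftrightarrow>
     (\<exists>js. distinct js \<and> set js = {..<n} - {i} \<and>
           sorted_wrt (\<lambda>j j'. row_inner n A i j \<ge> row_inner n A i j') js \<and>
           S = set (take k js))"

text \<open>
  On the range of \<open>k\<close>. Two rows of the ring lattice at ring distance \<open>d\<close> overlap in about
  \<open>max 0 (k - d) + max 0 (k + d - n)\<close> places, which is constant for \<open>n - k \<le> d\<close> when \<open>k\<close> is at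
  least \<open>n / 2\<close>. If \<open>k / n\<close> tends to a limit strictly between \<open>2 / 3\<close> and 1, then nodes inside
  and outside the neighbourhood have the same overlap up to a bounded term, and consistency fails
  already for \<open>\<beta> = 0\<close>. The theorem therefore assumes \<open>3 k \<le> 2 n\<close>, which includes the
  small-world regime \<open>k = o(n)\<close>.
\<close>

end

theory Submission
  imports Defs
begin

text \<open>
  Write \<open>k = 2 h\<close>, \<open>q\<close> for the edge probability off the lattice, \<open>q + D\<close> for the one on it, and
  \<open>a = 1 - \<beta>\<close>, so that \<open>a / 4 \<le> D \<le> a\<close>. The mean of \<open>\<langle>A\<^sub>i, A\<^sub>j\<rangle>\<close> is affine, with slope \<open>D\<^sup>2\<close>, in the
  number of common lattice neighbours of \<open>i\<close> and \<open>j\<close>, up to a correction of at most \<open>2 q D\<close>.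
  That number is at least \<open>h - 1 + g\<close> at ring distance at most \<open>h - g\<close>, and at most \<open>h + 2\<close> outside
  the neighbourhood. The variance is of order \<open>k\<^sup>2 / n + k a\<^sup>2\<close>, so a Bernstein-type bound makes all
  the inner products deviate from their means by less than \<open>s\<close>, of order \<open>r a\<^sup>2 k\<close>, where \<open>r\<close> is the
  ratio of the two sides of the signal condition; Hoeffding's inequality would not be enough when
  \<open>k\<close> is small compared to \<open>n\<close>. Hence, for some \<open>g\<close> of order \<open>r k + \<surd>k\<close>, all nodes at distance at
  most \<open>h - g\<close> are ranked above all nodes outside the neighbourhood, and at most \<open>2 g\<close> neighbours
  are missed.
\<close>

section \<open>Balls on the ring\<close>

text \<open>Offsets are signed integers, so that a ball becomes the image of an interval and
  counting on the ring becomes counting in an interval.\<close>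

definition rotate_node :: "nat \<Rightarrow> nat \<Rightarrow> int \<Rightarrow> nat" where
  "rotate_node n a x = nat ((int a + x) mod int n)"

lemma rotate_node_less: "0 < n \<Longrightarrow> rotate_node n a x < n"
  by (simp add: rotate_node_def nat_less_iff)

lemma rotate_node_add: "0 < n \<Longrightarrow> rotate_node n (rotate_node n a x) y = rotate_node n a (x + y)"
  by (simp add: rotate_node_def mod_add_left_eq add.assoc)

lemma inj_on_rotate_node:
  assumes "0 < n" and "\<And>x y. x \<in> X \<Longrightarrow> y \<in> X \<Longrightarrow> x - y < int n"
  shows "inj_on (rotate_node n a) X"
proof (rule inj_onI)
  fix x y assume xy: "x \<in> X" "y \<in> X" and eq: "rotate_node n a x = rotate_node n a y"
  have "(int a + x) mod int n = (int a + y) mod int n"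
    using eq assms(1) by (simp add: rotate_node_def eq_nat_nat_iff)
  then have "int n dvd x - y"
    by (metis add_diff_cancel_left mod_eq_dvd_iff)
  moreover have "\<bar>x - y\<bar> < int n"
    using assms(2)[OF xy] assms(2)[OF xy(2,1)] by linarith
  ultimately show "x = y"
    using zdvd_not_zless[of "\<bar>x - y\<bar>" "int n"] by (cases "x = y") auto
qed

lemma card_rotate_node_image:
  assumes "0 < n" "\<And>x y. x \<in> X \<Longrightarrow> y \<in> X \<Longrightarrow> x - y < int n"
  shows "card (rotate_node n a ` X) = card X"
  using inj_on_rotate_node[OF assms] by (simp add: card_image)

lemma ring_dist_commute: "ring_dist n i j = ring_dist n j i"
  by (simp add: ring_dist_def abs_minus_commute)

definition ring_ball :: "nat \<Rightarrow> nat \<Rightarrow> nat \<Rightarrow> nat set" where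
  "ring_ball n a h = {l. l < n \<and> ring_dist n a l \<le> int h}"

lemma finite_ring_ball [simp]: "finite (ring_ball n a h)"
  by (simp add: ring_ball_def)

lemma ring_dist_rotate_node:
  assumes "a < n" "\<bar>x\<bar> < int n"
  shows "ring_dist n a (rotate_node n a x) = min \<bar>x\<bar> (int n - \<bar>x\<bar>)"
proof -
  consider "int a + x < 0" | "0 \<le> int a + x" "int a + x < int n" | "int n \<le> int a + x" by linarith
  then show ?thesis
  proof cases
    case 1
    have "(int a + x) mod int n = (int a + x + int n) mod int n" by simp
    also have "\<dots> = int a + x + int n" using 1 assms by (intro mod_pos_pos_trivial) auto
    finally show ?thesis using 1 assms by (simp add: rotate_node_def ring_dist_def)
  next
    case 2
    then show ?thesis using assms by (simp add: rotate_node_def ring_dist_def)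
  next
    case 3
    have "(int a + x) mod int n = (int a + x - int n) mod int n" by simp
    also have "\<dots> = int a + x - int n" using 3 assms by (intro mod_pos_pos_trivial) auto
    finally show ?thesis using 3 assms by (simp add: rotate_node_def ring_dist_def)
  qed
qed

lemma ring_ball_eq_image:
  assumes "a < n" "2 * h < n"
  shows "ring_ball n a h = rotate_node n a ` {- int h..int h}"
proof (intro set_eqI iffI)
  fix l assume "l \<in> ring_ball n a h"
  then have l: "l < n" "ring_dist n a l \<le> int h" by (auto simp: ring_ball_def)
  then consider "\<bar>int a - int l\<bar> \<le> int h" | "int n - \<bar>int a - int l\<bar> \<le> int h" "a \<le> l"
    | "int n - \<bar>int a - int l\<bar> \<le> int h" "l \<le> a"
    by (fastforce simp: ring_dist_def)
  then show "l \<in> rotate_node n a ` {- int h..int h}"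
  proof cases
    case 1
    then show ?thesis using l
      by (intro image_eqI[where x = "int l - int a"]) (auto simp: rotate_node_def)
  next
    case 2
    then show ?thesis using l
      by (intro image_eqI[where x = "int l - int a - int n"]) (auto simp: rotate_node_def)
  next
    case 3
    then show ?thesis using l
      by (intro image_eqI[where x = "int l - int a + int n"]) (use assms in \<open>auto simp: rotate_node_def\<close>)
  qed
next
  fix l assume "l \<in> rotate_node n a ` {- int h..int h}"
  then show "l \<in> ring_ball n a h"
    using assms rotate_node_less[of n a] ring_dist_rotate_node[of a n]
    by (auto simp: ring_ball_def)
qed

lemma card_ring_ball:
  assumes "a < n" "2 * h < n"
  shows "card (ring_ball n a h) = 2 * h + 1"
  unfolding ring_ball_eq_image[OF assms] using assms
  by (subst card_rotate_node_image) auto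

lemma ring_dist_nonneg: "a < n \<Longrightarrow> c < n \<Longrightarrow> 0 \<le> ring_dist n a c"
  by (auto simp: ring_dist_def)

text \<open>The shorter arc runs forwards either from \<open>a\<close> to \<open>c\<close> or from
  \<open>c\<close> to \<open>a\<close>. Facts symmetric in the two nodes can thus be proved for a
  forward rotation.\<close>

lemma ring_dist_rotation:
  assumes "a < n" "c < n"
  obtains "c = rotate_node n a (ring_dist n a c)" | "a = rotate_node n c (ring_dist n a c)"
proof -
  have *: "c = rotate_node n a (ring_dist n a c) \<or> a = rotate_node n c (ring_dist n a c)"
    if "a \<le> c" "a < n" "c < n" for a c
  proof (cases "2 * (c - a) \<le> n")
    case True
    then have "ring_dist n a c = int c - int a"
      using that by (auto simp: ring_dist_def)
    then show ?thesis using that by (auto simp: rotate_node_def)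
  next
    case False
    then have "ring_dist n a c = int n - (int c - int a)"
      using that by (auto simp: ring_dist_def)
    then show ?thesis using that by (auto simp: rotate_node_def)
  qed
  show ?thesis
    using *[of a c] *[of c a] assms that by (cases "a \<le> c") (auto simp: ring_dist_commute)
qed

text \<open>With \<open>c\<close> at offset \<open>d\<close> from \<open>a\<close>, the offsets from
  \<open>d - h\<close> to \<open>h\<close> lie in both balls and are \<open>2 h + 1 - d\<close> in
  number.\<close>

lemma card_ring_ball_inter_ge:
  assumes "a < n" "c < n" "2 * h < n" "ring_dist n a c \<le> int h"
  shows "2 * int h + 1 - ring_dist n a c \<le> card (ring_ball n a h \<inter> ring_ball n c h)"
proof -
  have *: "2 * int h + 1 - d \<le> card (ring_ball n a h \<inter> ring_ball n c h)"
    if "a < n" "c = rotate_node n a d" "0 \<le> d" "d \<le> int h" for a c d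
  proof -
    have n: "0 < n" using that by simp
    have c: "c < n" using that rotate_node_less n by simp
    have "rotate_node n a x \<in> ring_ball n a h \<inter> ring_ball n c h" if "x \<in> {d - int h..int h}" for x
    proof -
      have "rotate_node n a x \<in> ring_ball n a h"
        using that \<open>0 \<le> d\<close> \<open>a < n\<close> assms(3) by (auto simp: ring_ball_eq_image)
      moreover have "rotate_node n a x = rotate_node n c (x - d)"
        using \<open>c = rotate_node n a d\<close> n by (simp add: rotate_node_add)
      then have "rotate_node n a x \<in> ring_ball n c h"
        using that \<open>0 \<le> d\<close> \<open>d \<le> int h\<close> c assms(3) by (auto simp: ring_ball_eq_image)
      ultimately show ?thesis by blast
    qed
    then have "card (rotate_node n a ` {d - int h..int h}) \<le> card (ring_ball n a h \<inter> ring_ball n c h)"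
      by (intro card_mono) auto
    then show ?thesis
      using that assms(3) n by (subst (asm) card_rotate_node_image) auto
  qed
  show ?thesis
    using ring_dist_rotation[OF assms(1,2)]
    by (metis * assms Int_commute ring_dist_nonneg)
qed

text \<open>The hypothesis \<open>3 h \<le> n\<close> keeps the two balls from overlapping also on the far side of the ring.\<close>

lemma card_ring_ball_inter_le:
  assumes "a < n" "c < n" "3 * h \<le> n" "2 * h < n" "int h < ring_dist n a c"
  shows "card (ring_ball n a h \<inter> ring_ball n c h) \<le> h + 2"
proof -
  have *: "card (ring_ball n a h \<inter> ring_ball n c h) \<le> h + 2"
    if "a < n" "c = rotate_node n a d" "int h < d" "2 * d \<le> int n" for a c d
  proof -
    have n: "0 < n" using that by simp
    have c: "c < n" using that rotate_node_less n by simp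
    have in_c: "rotate_node n a x \<in> ring_ball n c h" if "x \<in> {d - int h..d + int h}" for x
    proof -
      have "rotate_node n a x = rotate_node n c (x - d)"
        using \<open>c = rotate_node n a d\<close> n by (simp add: rotate_node_add)
      then show ?thesis
        using that c assms(4) by (auto simp: ring_ball_eq_image)
    qed
    have in_a: "rotate_node n a x \<in> ring_ball n a h" if "x \<in> {- int h..int h}" for x
      using that \<open>a < n\<close> assms(4) by (auto simp: ring_ball_eq_image)
    \<comment> \<open>By inclusion-exclusion it is enough that the union has at least
      \<open>3 h\<close> points. \<open>X\<close> adds to the ball around \<open>a\<close> another
      \<open>h - 1\<close> offsets from the ball around \<open>c\<close>, all within a window
      shorter than \<open>n\<close>, so that no two coincide on the ring.\<close>
    define X where "X = {- int h..int h} \<union>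
      (if d \<le> 2 * int h + 1 then {int h + 1..2 * int h - 1} else {d - int h..d - 2})"
    have card_X: "card X = (2 * h + 1) + (h - 1)"
      unfolding X_def by (subst card_Un_disjoint) auto
    have "rotate_node n a ` X \<subseteq> ring_ball n a h \<union> ring_ball n c h"
      using in_a in_c \<open>int h < d\<close> unfolding X_def by (auto split: if_splits)
    then have "card (rotate_node n a ` X) \<le> card (ring_ball n a h \<union> ring_ball n c h)"
      by (intro card_mono) auto
    moreover have "card (rotate_node n a ` X) = card X"
      using n that assms(3,4) by (intro card_rotate_node_image) (auto simp: X_def split: if_splits)
    moreover have "card (ring_ball n a h) + card (ring_ball n c h) =
        card (ring_ball n a h \<union> ring_ball n c h) + card (ring_ball n a h \<inter> ring_ball n c h)"
      by (intro card_Un_Int) auto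
    ultimately show ?thesis
      using card_X c that(1) assms(4) by (simp add: card_ring_ball)
  qed
  have "2 * ring_dist n a c \<le> int n" by (auto simp: ring_dist_def min_def)
  then show ?thesis
    using ring_dist_rotation[OF assms(1,2)]
    by (metis * assms Int_commute)
qed

section \<open>Concentration of sums of Bernoulli variables\<close>

lemma exp_le_quadratic:
  assumes "\<bar>x\<bar> \<le> (1::real)"
  shows "exp x \<le> 1 + x + x\<^sup>2"
proof (cases "0 \<le> x")
  case True
  then show ?thesis using assms by (intro exp_bound) auto
next
  case False
  define y where "y = - x"
  have y: "0 < y" using False by (simp add: y_def)
  have "1 \<le> 1 + y ^ 3" using y by simp
  also have "\<dots> = (1 - y + y\<^sup>2) * (1 + y)" by (simp add: algebra_simps power2_eq_square power3_eq_cube)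
  finally have "1 / (1 + y) \<le> 1 - y + y\<^sup>2" using y by (simp add: field_simps)
  moreover have "exp x \<le> 1 / (1 + y)"
    using exp_ge_add_one_self[of y] y by (simp add: y_def exp_minus field_simps)
  ultimately show ?thesis by (simp add: y_def)
qed

context prob_space
begin

text \<open>An exponential of an indicator is affine in it, so its mean is explicit. The exponent of
  the bound is proportional to \<open>m\<close>, which is the gain over Hoeffding for rare
  events.\<close>

lemma bernoulli_centered_mgf_le:
  assumes [measurable]: "X \<in> measurable M (count_space (UNIV :: bool set))"
    and "\<bar>r\<bar> \<le> 1"
  defines "m \<equiv> prob {\<omega> \<in> space M. X \<omega>}"
  shows "expectation (\<lambda>\<omega>. exp (r * (of_bool (X \<omega>) - m))) \<le> exp (r\<^sup>2 * m)"
proof -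
  have "expectation (\<lambda>\<omega>. exp (r * (of_bool (X \<omega>) - m))) =
      expectation (\<lambda>\<omega>. exp (- r * m) * (1 + (exp r - 1) * indicator {\<omega> \<in> space M. X \<omega>} \<omega>))"
    by (intro Bochner_Integration.integral_cong)
      (auto simp: algebra_simps exp_diff exp_minus divide_inverse)
  also have "\<dots> = exp (- r * m) * (1 + (exp r - 1) * m)"
    by (subst Bochner_Integration.integral_mult_right_zero,
        subst Bochner_Integration.integral_add)
      (auto simp: prob_space m_def intro!: integrable_mult_right integrable_real_indicator
        emeasure_finite[THEN less_top[THEN iffD1]])
  also have "\<dots> \<le> exp (- r * m) * exp ((r + r\<^sup>2) * m)"
  proof (intro mult_left_mono)
    have "(exp r - 1) * m \<le> (r + r\<^sup>2) * m"
      using exp_le_quadratic[OF assms(2)] by (intro mult_right_mono) (auto simp: m_def)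
    then show "1 + (exp r - 1) * m \<le> exp ((r + r\<^sup>2) * m)"
      using exp_ge_add_one_self[of "(r + r\<^sup>2) * m"] by linarith
  qed auto
  also have "\<dots> = exp (r\<^sup>2 * m)" by (simp add: algebra_simps flip: exp_add)
  finally show ?thesis .
qed

text \<open>Chernoff's method with the parameter \<open>r\<close> left free; a negative
  \<open>r\<close> gives the lower tail.\<close>

lemma bernoulli_sum_upper_tail:
  assumes L: "finite L" and indep: "indep_vars (\<lambda>_. count_space UNIV) X L"
    and r: "\<bar>r\<bar> \<le> 1"
  defines "m \<equiv> \<lambda>l. prob {\<omega> \<in> space M. X l \<omega>}"
  shows "prob {\<omega> \<in> space M. t \<le> r * ((\<Sum>l\<in>L. of_bool (X l \<omega>)) - (\<Sum>l\<in>L. m l))}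
    \<le> exp (r\<^sup>2 * (\<Sum>l\<in>L. m l) - t)"
proof -
  define Y where "Y = (\<lambda>l \<omega>. exp (r * (of_bool (X l \<omega>) - m l)))"
  have X: "X l \<in> measurable M (count_space UNIV)" if "l \<in> L" for l
    using indep that by (auto simp: indep_vars_def)
  have indep_Y: "indep_vars (\<lambda>_. borel) Y L"
    unfolding Y_def using indep by (rule indep_vars_compose2) simp
  have int_Y: "integrable M (Y l)" if "l \<in> L" for l
  proof (rule integrable_const_bound[where B = "exp 1"])
    have "r * (of_bool b - m l) \<le> 1" for b
    proof -
      have "0 \<le> m l" "m l \<le> 1" by (auto simp: m_def)
      then have "\<bar>of_bool b - m l\<bar> \<le> 1" by (cases b) auto
      then have "\<bar>r * (of_bool b - m l)\<bar> \<le> 1"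
        using r mult_mono[of "\<bar>r\<bar>" 1 "\<bar>of_bool b - m l\<bar>" 1] by (simp add: abs_mult)
      then show ?thesis by (rule abs_le_D1)
    qed
    then show "AE \<omega> in M. norm (Y l \<omega>) \<le> exp 1" by (simp add: Y_def)
    show "Y l \<in> borel_measurable M"
      using indep_Y that by (auto simp: indep_vars_def)
  qed
  have prod_Y: "(\<Prod>l\<in>L. Y l \<omega>) = exp (r * ((\<Sum>l\<in>L. of_bool (X l \<omega>)) - (\<Sum>l\<in>L. m l)))" for \<omega>
    using L by (simp add: Y_def exp_sum[symmetric] sum_distrib_left sum_subtractf algebra_simps)
  have "{\<omega> \<in> space M. t \<le> r * ((\<Sum>l\<in>L. of_bool (X l \<omega>)) - (\<Sum>l\<in>L. m l))} =
      {\<omega> \<in> space M. (\<Prod>l\<in>L. Y l \<omega>) \<ge> exp t}"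
    by (simp add: prod_Y)
  also have "prob \<dots> \<le> expectation (\<lambda>\<omega>. \<Prod>l\<in>L. Y l \<omega>) / exp t"
    by (rule integral_Markov_inequality_measure[where A = "{}"])
      (use indep_vars_integrable[OF L indep_Y int_Y] in \<open>auto simp: prod_Y\<close>)
  also have "expectation (\<lambda>\<omega>. \<Prod>l\<in>L. Y l \<omega>) = (\<Prod>l\<in>L. expectation (Y l))"
    by (intro indep_vars_lebesgue_integral L indep_Y int_Y)
  also have "\<dots> \<le> (\<Prod>l\<in>L. exp (r\<^sup>2 * m l))"
    unfolding Y_def m_def
    by (intro prod_mono conjI bernoulli_centered_mgf_le[OF X r] integral_nonneg) auto
  also have "(\<Prod>l\<in>L. exp (r\<^sup>2 * m l)) = exp (r\<^sup>2 * (\<Sum>l\<in>L. m l))"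
    using L by (simp add: exp_sum sum_distrib_left)
  finally show ?thesis by (simp add: exp_diff divide_right_mono)
qed

text \<open>The parameter \<open>4 * c / s\<close> is at most 1 by the first bound on
  \<open>s\<close>, and the second makes the quadratic term at most \<open>c\<close>. Each tail is
  then at most \<open>exp (c - 4 * c)\<close>.\<close>

lemma bernoulli_sum_concentration:
  assumes L: "finite L" and indep: "indep_vars (\<lambda>_. count_space UNIV) X L"
  defines "\<mu> \<equiv> \<Sum>l\<in>L. prob {\<omega> \<in> space M. X l \<omega>}"
  assumes c: "0 < c" "4 * c \<le> s" "\<mu> \<le> V" "16 * V * c \<le> s\<^sup>2"
  shows "prob {\<omega> \<in> space M. s \<le> \<bar>(\<Sum>l\<in>L. of_bool (X l \<omega>)) - \<mu>\<bar>} \<le> 2 * exp (- 3 * c)"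
proof -
  have s: "0 < s" using c by linarith
  define r where "r = 4 * c / s"
  define E where "E = (\<lambda>r. {\<omega> \<in> space M. 4 * c \<le> r * ((\<Sum>l\<in>L. of_bool (X l \<omega>)) - \<mu>)})"
  have r: "0 < r" "r \<le> 1" "r * s = 4 * c" using c s by (auto simp: r_def)
  have "r\<^sup>2 * \<mu> \<le> r\<^sup>2 * V" using c by (intro mult_left_mono) auto
  also have "\<dots> = 16 * V * c * c / s\<^sup>2" by (simp add: r_def power_divide power2_eq_square)
  also have "\<dots> \<le> s\<^sup>2 * c / s\<^sup>2" using c by (intro divide_right_mono mult_right_mono) auto
  also have "\<dots> = c" using s by simp
  finally have quad: "r\<^sup>2 * \<mu> \<le> c" .
  have X[measurable]: "X l \<in> measurable M (count_space UNIV)" if "l \<in> L" for l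
    using indep that by (auto simp: indep_vars_def)
  have meas: "E r \<in> events" for r
    unfolding E_def by measurable
  have tail: "prob (E l) \<le> exp (- 3 * c)" if "l\<^sup>2 = r\<^sup>2" for l
  proof -
    have "\<bar>l\<bar> \<le> 1" using that r by (simp add: power2_eq_iff abs_if) auto
    then have "prob (E l) \<le> exp (l\<^sup>2 * \<mu> - 4 * c)"
      unfolding E_def \<mu>_def by (rule bernoulli_sum_upper_tail[OF L indep])
    also have "\<dots> \<le> exp (- 3 * c)" using quad that by simp
    finally show ?thesis .
  qed
  have "{\<omega> \<in> space M. s \<le> \<bar>(\<Sum>l\<in>L. of_bool (X l \<omega>)) - \<mu>\<bar>} \<subseteq> E r \<union> E (- r)"
  proof clarify
    fix \<omega> assume \<omega>: "\<omega> \<in> space M" "s \<le> \<bar>(\<Sum>l\<in>L. of_bool (X l \<omega>)) - \<mu>\<bar>" "\<omega> \<notin> E (- r)"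
    have "4 * c \<le> r * \<bar>(\<Sum>l\<in>L. of_bool (X l \<omega>)) - \<mu>\<bar>"
      using \<omega>(2) r mult_left_mono[of s _ r] by fastforce
    then show "\<omega> \<in> E r"
      using \<omega> by (auto simp: E_def abs_if split: if_splits)
  qed
  then have "prob {\<omega> \<in> space M. s \<le> \<bar>(\<Sum>l\<in>L. of_bool (X l \<omega>)) - \<mu>\<bar>} \<le> prob (E r \<union> E (- r))"
    using meas by (intro finite_measure_mono) auto
  also have "\<dots> \<le> prob (E r) + prob (E (- r))"
    using meas by (intro measure_Un_le) auto
  also have "\<dots> \<le> 2 * exp (- 3 * c)" using tail[of r] tail[of "- r"] by simp
  finally show ?thesis .
qed

end

lemma prob_Pi_pmf_bernoulli_pair:
  assumes "finite I" "x \<in> I" "y \<in> I" "x \<noteq> y" "p x \<in> {0..1}" "p y \<in> {0..1}"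
  shows "measure_pmf.prob (Pi_pmf I d (\<lambda>x. bernoulli_pmf (p x))) {e. e x \<and> e y} = p x * p y"
proof -
  define B where "B = (\<lambda>z. if z = x \<or> z = y then {True} else UNIV)"
  have "{e. e x \<and> e y} = Pi I B"
    using assms by (auto simp: B_def Pi_def)
  then have "measure_pmf.prob (Pi_pmf I d (\<lambda>x. bernoulli_pmf (p x))) {e. e x \<and> e y} =
      (\<Prod>z\<in>I. measure_pmf.prob (bernoulli_pmf (p z)) (B z))"
    using assms by (simp add: measure_Pi_pmf_Pi)
  also have "\<dots> = (\<Prod>z\<in>{x, y}. measure_pmf.prob (bernoulli_pmf (p z)) (B z))"
    using assms by (intro prod.mono_neutral_right) (auto simp: B_def)
  also have "\<dots> = p x * p y"
    using assms by (simp add: B_def measure_pmf_single)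
  finally show ?thesis .
qed

text \<open>Functions of disjoint blocks of independent coordinates are independent.\<close>

lemma indep_vars_Pi_pmf_pairs:
  assumes "finite I" "u ` L \<subseteq> I" "v ` L \<subseteq> I" "disjoint_family_on (\<lambda>l. {u l, v l}) L"
  shows "prob_space.indep_vars (measure_pmf (Pi_pmf I d p)) (\<lambda>_. count_space UNIV)
    (\<lambda>l e. e (u l) \<and> e (v l)) L"
proof -
  have "prob_space.indep_vars (measure_pmf (Pi_pmf I d p)) (\<lambda>l. PiM {u l, v l} (\<lambda>_. count_space UNIV))
      (\<lambda>l e. restrict (\<lambda>x. e x) {u l, v l}) L"
    using assms by (intro prob_space.indep_vars_restrict[OF measure_pmf.prob_space_axioms indep_vars_Pi_pmf]) auto
  then have "prob_space.indep_vars (measure_pmf (Pi_pmf I d p)) (\<lambda>_. count_space UNIV)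
      (\<lambda>l e. restrict (\<lambda>x. e x) {u l, v l} (u l) \<and> restrict (\<lambda>x. e x) {u l, v l} (v l)) L"
    by (rule prob_space.indep_vars_compose2[OF measure_pmf.prob_space_axioms,
          where Y = "\<lambda>l f. f (u l) \<and> f (v l)"]) measurable
  then show ?thesis by simp
qed

section \<open>Ranking\<close>

text \<open>If some \<open>x\<close> of \<open>C\<close> were missed, every selected element would
  score at least \<open>f x\<close> and so, by the gap, lie in \<open>N\<close>. The selection has
  as many elements as \<open>N\<close>, hence would be \<open>N\<close> and contain
  \<open>x\<close>.\<close>

lemma take_top_contains:
  assumes js: "distinct js" "sorted_wrt (\<lambda>x y. f y \<le> (f x :: real)) js" "card N \<le> length js"
    and C: "C \<subseteq> N" "C \<subseteq> set js" "finite N"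
    and gap: "\<And>x y. x \<in> C \<Longrightarrow> y \<in> set js - N \<Longrightarrow> f y < f x"
  shows "C \<subseteq> set (take (card N) js)"
proof
  fix x assume x: "x \<in> C"
  show "x \<in> set (take (card N) js)"
  proof (rule ccontr)
    assume "x \<notin> set (take (card N) js)"
    moreover have "x \<in> set js" using x C by auto
    then have "x \<in> set (take (card N) js) \<union> set (drop (card N) js)"
      by (metis append_take_drop_id set_append)
    ultimately have "x \<in> set (drop (card N) js)" by blast
    moreover have "sorted_wrt (\<lambda>x y. f y \<le> f x) (take (card N) js @ drop (card N) js)"
      using js by simp
    ultimately have "f x \<le> f y" if "y \<in> set (take (card N) js)" for y
      using that unfolding sorted_wrt_append by blast
    then have "set (take (card N) js) \<subseteq> N"
      using gap[OF x] by (meson DiffI in_set_takeD not_le subsetI)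
    moreover have "card (set (take (card N) js)) = card N"
      using js by (subst distinct_card) auto
    ultimately have "set (take (card N) js) = N"
      using C by (simp add: card_subset_eq)
    then show False using x C \<open>x \<notin> set (take (card N) js)\<close> by auto
  qed
qed

text \<open>Equal cardinalities make the two halves of the symmetric difference equally large, and
  \<open>N - S\<close> avoids \<open>C\<close>.\<close>

lemma card_sym_diff_le:
  assumes "finite S" "finite N" "card S = card N" "C \<subseteq> S" "C \<subseteq> N"
  shows "card (sym_diff S N) \<le> 2 * card (N - C)"
proof -
  have "card (sym_diff S N) = card (S - N) + card (N - S)"
    using assms by (intro card_Un_disjoint) auto
  also have "card (S - N) = card (N - S)"
    using assms card_Int_Diff[of S N] card_Int_Diff[of N S] by (simp add: Int_commute)
  also have "card (N - S) \<le> card (N - C)"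
    using assms by (intro card_mono) auto
  finally show ?thesis by simp
qed

section \<open>The Watts--Strogatz model\<close>

text \<open>Here \<open>h\<close> is half the neighbourhood size, so \<open>h_le\<close> reads
  \<open>3 k \<le> 2 n\<close>. Together with \<open>9 \<le> n\<close> it gives
  \<open>q \<le> 3 / 4\<close>, which keeps \<open>D\<close> at least a quarter of
  \<open>1 - \<beta>\<close>.\<close>

locale small_world =
  fixes n h :: nat and \<beta> :: real and \<pi> :: "nat \<Rightarrow> nat"
  assumes n_ge: "9 \<le> n" and h_pos: "0 < h" and h_le: "3 * h \<le> n"
    and \<beta>_nonneg: "0 \<le> \<beta>" and \<beta>_le: "\<beta> \<le> 1" and perm: "\<pi> permutes {..<n}"
begin

abbreviation N :: "nat \<Rightarrow> nat set" where "N \<equiv> true_nbhd n (2 * h) \<pi>"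

abbreviation G :: "matrix pmf" where "G \<equiv> watts_strogatz n (2 * h) \<beta> \<pi>"

definition q :: real where "q = \<beta> * (real (2 * h) / (real n - 1))"

definition D :: real where "D = (1 - \<beta>) * (1 - q)"

abbreviation pos :: "nat \<Rightarrow> nat" where "pos \<equiv> inv \<pi>"

section \<open>Neighbourhoods seen from ring positions\<close>

lemma h_less: "2 * h < n"
  using h_le h_pos n_ge by simp

lemma pos_less: "pos i < n \<longleftrightarrow> i < n"
  using permutes_in_image[OF permutes_inv[OF perm], of i] by simp

lemma pos_eq_iff: "pos i = pos j \<longleftrightarrow> i = j"
  by (rule inj_eq[OF permutes_inj[OF permutes_inv[OF perm]]])

lemma pos_image: "\<pi> ` {l. l < n \<and> P l} = {l. l < n \<and> P (pos l)}"
proof (intro set_eqI iffI)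
  fix l assume "l \<in> {l. l < n \<and> P (pos l)}"
  then have "pos l \<in> {l. l < n \<and> P l}" by (simp add: pos_less)
  then have "\<pi> (pos l) \<in> \<pi> ` {l. l < n \<and> P l}" by (rule imageI)
  then show "l \<in> \<pi> ` {l. l < n \<and> P l}" by (simp only: permutes_inverses(1)[OF perm])
next
  fix l assume "l \<in> \<pi> ` {l. l < n \<and> P l}"
  then obtain m where m: "l = \<pi> m" "m < n" "P m" by auto
  then have "pos l = m" by (simp only: permutes_inverses(2)[OF perm])
  then show "l \<in> {l. l < n \<and> P (pos l)}"
    using m pos_less[of l] by auto
qed

text \<open>Lets cardinalities be computed at ring positions, where neighbourhoods are balls without
  their centre.\<close>

lemma card_pos: "card {l. l < n \<and> P (pos l)} = card {l. l < n \<and> P l}"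
  unfolding pos_image[symmetric] by (intro card_image inj_on_subset[OF permutes_inj[OF perm]]) auto

lemma mem_N: "l \<in> N i \<longleftrightarrow> l < n \<and> l \<noteq> i \<and> ring_dist n (pos i) (pos l) \<le> int h"
  by (auto simp: true_nbhd_def)

lemma mem_N_commute: "i < n \<Longrightarrow> j < n \<Longrightarrow> i \<in> N j \<longleftrightarrow> j \<in> N i"
  by (auto simp: mem_N ring_dist_commute)

lemma N_subset: "N i \<subseteq> {..<n} - {i}"
  by (auto simp: mem_N)

lemma finite_N [simp]: "finite (N i)"
  by (rule finite_subset[OF N_subset]) simp

text \<open>Radius \<open>h\<close> gives the size of the neighbourhood, radius \<open>h - g\<close>
  the size of the core that is ranked reliably.\<close>

lemma card_N_near:
  assumes "i < n" "g \<le> h"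
  shows "card {l \<in> N i. ring_dist n (pos i) (pos l) \<le> int g} = 2 * g"
proof -
  have pos_i: "pos i < n" using assms(1) by (simp add: pos_less)
  then have i: "pos i \<in> ring_ball n (pos i) g" by (simp add: ring_ball_def ring_dist_def)
  let ?P = "\<lambda>l. l \<noteq> pos i \<and> ring_dist n (pos i) l \<le> int g"
  have "{l \<in> N i. ring_dist n (pos i) (pos l) \<le> int g} = {l. l < n \<and> ?P (pos l)}"
    using assms by (auto simp: mem_N pos_eq_iff)
  moreover have "{l. l < n \<and> ?P l} = ring_ball n (pos i) g - {pos i}"
    by (auto simp: ring_ball_def)
  moreover have "card (ring_ball n (pos i) g - {pos i}) = 2 * g"
    using assms(2) h_less by (simp add: i card_ring_ball[OF pos_i])
  ultimately show ?thesis
    using card_pos[of ?P] by (simp only:)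
qed

lemma card_N: "i < n \<Longrightarrow> card (N i) = 2 * h"
proof -
  assume i: "i < n"
  have "{l \<in> N i. ring_dist n (pos i) (pos l) \<le> int h} = N i"
    by (auto simp: mem_N)
  then show ?thesis using card_N_near[OF i order_refl] by simp
qed

lemma card_N_Int:
  assumes "i < n" "j < n"
  shows "card (N i \<inter> N j) = card (ring_ball n (pos i) h \<inter> ring_ball n (pos j) h - {pos i, pos j})"
proof -
  let ?P = "\<lambda>l. l \<noteq> pos i \<and> l \<noteq> pos j \<and>
    ring_dist n (pos i) l \<le> int h \<and> ring_dist n (pos j) l \<le> int h"
  have "N i \<inter> N j = {l. l < n \<and> ?P (pos l)}"
    by (auto simp: mem_N pos_eq_iff)
  moreover have "{l. l < n \<and> ?P l} = ring_ball n (pos i) h \<inter> ring_ball n (pos j) h - {pos i, pos j}"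
    by (auto simp: ring_ball_def)
  ultimately show ?thesis
    using card_pos[of ?P] by (simp only:)
qed

text \<open>The two balls share at least \<open>h + 1 + g\<close> points, of which at most two, the
  centres, are not common neighbours.\<close>

lemma overlap_inside:
  assumes "i < n" "j < n" "ring_dist n (pos i) (pos j) \<le> int h - int g"
  shows "real h - 1 + real g \<le> real (card (N i \<inter> N j))"
proof -
  let ?X = "ring_ball n (pos i) h \<inter> ring_ball n (pos j) h"
  have "2 * int h + 1 - ring_dist n (pos i) (pos j) \<le> card ?X"
    using assms h_less by (intro card_ring_ball_inter_ge) (auto simp: pos_less)
  moreover have "card ?X \<le> card (?X - {pos i, pos j}) + card {pos i, pos j}"
    by (rule order_trans[OF card_mono card_Un_le]) auto
  moreover have "card {pos i, pos j} \<le> 2" by (simp add: card_insert_if)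
  ultimately show ?thesis
    using assms card_N_Int[of i j] by linarith
qed

lemma overlap_outside:
  assumes "i < n" "j < n" "int h < ring_dist n (pos i) (pos j)"
  shows "real (card (N i \<inter> N j)) \<le> real h + 2"
proof -
  have "card (ring_ball n (pos i) h \<inter> ring_ball n (pos j) h) \<le> h + 2"
    using assms h_le h_less by (intro card_ring_ball_inter_le) (auto simp: pos_less)
  moreover have "card (N i \<inter> N j) \<le> card (ring_ball n (pos i) h \<inter> ring_ball n (pos j) h)"
    unfolding card_N_Int[OF assms(1,2)] by (intro card_mono) auto
  ultimately show ?thesis by linarith
qed

section \<open>Edge probabilities and the means of the inner products\<close>

definition edge_prob :: "nat \<Rightarrow> nat \<Rightarrow> real" where
  "edge_prob i j = q + D * of_bool (j \<in> N i)"

lemma ws_edge_prob_eq: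
  assumes "j < n"
  shows "ws_edge_prob n (2 * h) \<beta> \<pi> i j = edge_prob i j"
proof -
  have "conj_perm \<pi> (ring_lattice n (2 * h)) i j = of_bool (j \<in> N i)"
    using assms by (auto simp: conj_perm_def ring_lattice_def mem_N pos_eq_iff)
  moreover have "1 - \<beta> * (1 - q) = q + D"
    by (simp add: D_def algebra_simps)
  ultimately show ?thesis
    unfolding ws_edge_prob_def edge_prob_def q_def[symmetric] by simp
qed

lemma edge_prob_commute: "i < n \<Longrightarrow> j < n \<Longrightarrow> edge_prob i j = edge_prob j i"
  by (simp add: edge_prob_def mem_N_commute)

lemma q_nonneg: "0 \<le> q" and q_le: "q \<le> 4 * real h / real n" and q_le': "q \<le> 3 / 4"
proof -
  have nn: "8 * real n \<le> 9 * (real n - 1)" "0 < real n - 1" "real n \<le> 2 * (real n - 1)" using n_ge by auto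
  show "0 \<le> q" using \<beta>_nonneg nn by (simp add: q_def)
  have "q \<le> 1 * (real (2 * h) / (real n - 1))"
    unfolding q_def using \<beta>_le nn by (intro mult_right_mono) auto
  moreover have "real (2 * h) / (real n - 1) \<le> 4 * real h / real n"
  proof -
    have "real (2*h) * real n \<le> real (2*h) * (2 * (real n - 1))"
      using nn by (intro mult_left_mono) auto
    then show ?thesis using nn n_ge by (simp add: field_simps)
  qed
  moreover have "real (2 * h) / (real n - 1) \<le> 3 / 4"
    using nn h_le by (simp add: field_simps)
  ultimately show "q \<le> 4 * real h / real n" "q \<le> 3 / 4" by linarith+
qed

lemma D_ge: "(1 - \<beta>) / 4 \<le> D" and D_le: "D \<le> 1 - \<beta>"
proof -
  have "(1 - \<beta>) * (1 / 4) \<le> D" unfolding D_def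
    using \<beta>_le q_le' by (intro mult_left_mono) auto
  then show "(1 - \<beta>) / 4 \<le> D" by simp
  have "D \<le> (1 - \<beta>) * 1" unfolding D_def
    using \<beta>_le q_nonneg by (intro mult_left_mono) auto
  then show "D \<le> 1 - \<beta>" by simp
qed

lemma D_nonneg: "0 \<le> D"
  using \<beta>_le by (intro order_trans[OF _ D_ge]) simp

lemma edge_prob_01: "edge_prob i j \<in> {0..1}"
proof -
  have "q + D = 1 - \<beta> * (1 - q)" by (simp add: D_def algebra_simps)
  also have "\<dots> \<le> 1" using \<beta>_nonneg q_le' by simp
  finally show ?thesis using q_nonneg D_nonneg q_le' by (auto simp: edge_prob_def)
qed

text \<open>The indices \<open>i\<close> and \<open>j\<close> are left out because the zero diagonal
  annihilates their terms. For the others the two factors are independent, so means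
  multiply.\<close>

definition mean_inner :: "nat \<Rightarrow> nat \<Rightarrow> real" where
  "mean_inner i j = (\<Sum>l\<in>{..<n} - {i, j}. edge_prob i l * edge_prob j l)"

text \<open>Every edge probability is \<open>q\<close> plus \<open>D\<close> times an indicator, so
  the products expand into counts of neighbours and common neighbours. The \<open>of_bool\<close>
  term appears because lattice neighbours lose each other when \<open>i\<close> and \<open>j\<close>
  are left out.\<close>

lemma mean_inner_eq:
  assumes "i < n" "j < n" "i \<noteq> j"
  shows "mean_inner i j = (real n - 2) * q\<^sup>2 + 2 * q * D * (2 * real h - of_bool (j \<in> N i))
    + D\<^sup>2 * real (card (N i \<inter> N j))"
proof -
  define L where "L = {..<n} - {i, j}"
  have L: "finite L" by (simp add: L_def)
  have sum_of_bool: "(\<Sum>l\<in>L. of_bool (l \<in> S)) = real (card (S \<inter> L))" for S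
    using L by (simp add: of_bool_def sum.If_cases Int_commute)
  have card_L: "real (card L) = real n - 2"
    using assms by (simp add: L_def card_Diff_subset of_nat_diff)
  have "N i \<inter> L = N i - {j}" "N j \<inter> L = N j - {i}" "N i \<inter> N j \<inter> L = N i \<inter> N j"
    by (auto simp: L_def mem_N)
  then have cards: "real (card (N i \<inter> L)) = 2 * real h - of_bool (j \<in> N i)"
    "real (card (N j \<inter> L)) = 2 * real h - of_bool (j \<in> N i)"
    "card (N i \<inter> N j \<inter> L) = card (N i \<inter> N j)"
    using assms card_N[of i] card_N[of j] mem_N_commute[of i j] h_pos
    by (auto simp: card_Diff_singleton_if of_nat_diff)
  have "mean_inner i j = (\<Sum>l\<in>L. q\<^sup>2 + q * D * of_bool (l \<in> N i) + q * D * of_bool (l \<in> N j)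
      + D\<^sup>2 * of_bool (l \<in> N i \<inter> N j))"
    unfolding mean_inner_def L_def
    by (intro sum.cong) (auto simp: edge_prob_def algebra_simps power2_eq_square)
  also have "\<dots> = real (card L) * q\<^sup>2 + q * D * real (card (N i \<inter> L)) + q * D * real (card (N j \<inter> L))
      + D\<^sup>2 * real (card (N i \<inter> N j \<inter> L))"
    by (simp only: sum.distrib sum_of_bool sum_constant flip: sum_distrib_left)
  finally show ?thesis unfolding card_L cards by (simp add: algebra_simps)
qed

section \<open>Concentration of the inner products\<close>

definition adj :: "(nat \<times> nat \<Rightarrow> bool) \<Rightarrow> matrix" where
  "adj e i j = (if i < n \<and> j < n \<and> i \<noteq> j \<and> e (min i j, max i j) then 1 else 0)"

definition edges :: "(nat \<times> nat) set" where "edges = {(i, j). i < j \<and> j < n}"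

lemma finite_edges: "finite edges"
  by (rule finite_subset[of _ "{..<n} \<times> {..<n}"]) (auto simp: edges_def)

lemma G_eq: "G = map_pmf adj (Pi_pmf edges False
    (\<lambda>x. bernoulli_pmf (edge_prob (fst x) (snd x))))"
proof -
  have "Pi_pmf edges False (\<lambda>(i, j). bernoulli_pmf (ws_edge_prob n (2 * h) \<beta> \<pi> i j)) =
      Pi_pmf edges False (\<lambda>x. bernoulli_pmf (edge_prob (fst x) (snd x)))"
    by (intro Pi_pmf_cong) (auto simp: edges_def ws_edge_prob_eq)
  then show ?thesis
    by (simp add: watts_strogatz_def adj_def[abs_def] edges_def)
qed

lemma row_inner_adj:
  assumes "i < n" "j < n"
  shows "row_inner n (adj e) i j =
    (\<Sum>l\<in>{..<n} - {i, j}. of_bool (e (min i l, max i l) \<and> e (min j l, max j l)))"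
proof -
  have "row_inner n (adj e) i j = (\<Sum>l\<in>{..<n} - {i, j}. adj e i l * adj e j l)"
    unfolding row_inner_def by (intro sum.mono_neutral_right) (auto simp: adj_def)
  also have "\<dots> = (\<Sum>l\<in>{..<n} - {i, j}. of_bool (e (min i l, max i l) \<and> e (min j l, max j l)))"
    using assms by (intro sum.cong) (auto simp: adj_def)
  finally show ?thesis .
qed

text \<open>Each \<open>l\<close> contributes the product of the entries at \<open>{i, l}\<close> and \<open>{j, l}\<close>, and these pairs
  of entries are disjoint for different \<open>l\<close>.\<close>

lemma row_inner_concentration:
  assumes ij: "i < n" "j < n" "i \<noteq> j"
    and c: "0 < c" "4 * c \<le> s" "mean_inner i j \<le> V" "16 * V * c \<le> s\<^sup>2"
  shows "measure_pmf.prob G {A. s \<le> \<bar>row_inner n A i j - mean_inner i j\<bar>} \<le> 2 * exp (- 3 * c)"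
proof -
  define L where "L = {..<n} - {i, j}"
  have finL: "finite L" by (simp add: L_def)
  define P where "P = Pi_pmf edges False (\<lambda>x. bernoulli_pmf (edge_prob (fst x) (snd x)))"
  define u where "u = (\<lambda>i l :: nat. (min i l, max i l))"
  have u_edges: "u a l \<in> edges" if "l \<in> L" "a \<in> {i, j}" for a l
    using that ij by (auto simp: L_def u_def edges_def)
  have u_prob: "edge_prob (fst (u a l)) (snd (u a l)) = edge_prob a l" if "l \<in> L" "a \<in> {i, j}" for a l
    using that ij by (auto simp: L_def u_def min_def max_def edge_prob_commute)
  \<comment> \<open>This serves two purposes: the two entries for one \<open>l\<close> are distinct,
    and the entries for different \<open>l\<close> are disjoint. It rests on \<open>l\<close> and
    \<open>m\<close> lying outside \<open>{i, j}\<close>.\<close>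
  have u_eq: "u a l = u b m \<longleftrightarrow> a = b \<and> l = m" if "l \<in> L" "m \<in> L" "a \<in> {i, j}" "b \<in> {i, j}" for a b l m
    using that by (auto simp: L_def u_def min_def max_def split: if_splits)
  have indep: "prob_space.indep_vars (measure_pmf P) (\<lambda>_. count_space UNIV)
      (\<lambda>l e. e (u i l) \<and> e (u j l)) L"
    unfolding P_def
    by (intro indep_vars_Pi_pmf_pairs finite_edges)
      (use u_edges u_eq in \<open>auto simp: disjoint_family_on_def\<close>)
  have mean: "(\<Sum>l\<in>L. measure_pmf.prob P {e \<in> space P. e (u i l) \<and> e (u j l)}) = mean_inner i j"
    unfolding mean_inner_def
  proof (rule sum.cong)
    fix l assume "l \<in> {..<n} - {i, j}"
    then have l: "l \<in> L" by (simp add: L_def)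
    have "measure_pmf.prob P {e. e (u i l) \<and> e (u j l)} =
        edge_prob (fst (u i l)) (snd (u i l)) * edge_prob (fst (u j l)) (snd (u j l))"
      unfolding P_def using l ij u_eq[OF l l, of i j]
      by (intro prob_Pi_pmf_bernoulli_pair finite_edges u_edges edge_prob_01) auto
    then show "measure_pmf.prob P {e \<in> space P. e (u i l) \<and> e (u j l)} = edge_prob i l * edge_prob j l"
      using l by (simp add: u_prob)
  qed (simp add: L_def)
  have "measure_pmf.prob P {e \<in> space P. s \<le> \<bar>(\<Sum>l\<in>L. of_bool (e (u i l) \<and> e (u j l))) - mean_inner i j\<bar>}
      \<le> 2 * exp (- 3 * c)"
    using prob_space.bernoulli_sum_concentration[OF measure_pmf.prob_space_axioms finL indep c(1,2) _ c(4)] c(3)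
    unfolding mean by blast
  also have "{e \<in> space P. s \<le> \<bar>(\<Sum>l\<in>L. of_bool (e (u i l) \<and> e (u j l))) - mean_inner i j\<bar>} =
      adj -` {A. s \<le> \<bar>row_inner n A i j - mean_inner i j\<bar>}"
    using ij by (auto simp: row_inner_adj L_def u_def)
  finally show ?thesis by (simp add: G_eq P_def)
qed

text \<open>The mean of a sum of independent indicators also bounds its variance, so this serves as
  \<open>V\<close> in the concentration bound.\<close>

lemma mean_inner_le:
  assumes "i < n" "j < n" "i \<noteq> j"
  shows "mean_inner i j \<le> 32 * (real h)\<^sup>2 / real n + 4 * real h * (1 - \<beta>)\<^sup>2"
proof -
  have "card (N i \<inter> N j) \<le> card (N i)" by (intro card_mono) auto
  then have ov: "real (card (N i \<inter> N j)) \<le> 2 * real h" using card_N[OF assms(1)] by simp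
  have "mean_inner i j \<le> (real n - 2) * q\<^sup>2 + 2 * q * D * (2 * real h) + D\<^sup>2 * (2 * real h)"
    unfolding mean_inner_eq[OF assms] using ov q_nonneg D_nonneg
    by (intro add_mono mult_left_mono order_refl) auto
  also have "(real n - 2) * q\<^sup>2 \<le> real n * q\<^sup>2" by (intro mult_right_mono) auto
  \<comment> \<open>The mixed term is split by \<open>2 q D \<le> q^2 + D^2\<close>; then
    \<open>2 h < n\<close> absorbs its first half into \<open>n q^2\<close>.\<close>
  also have "2 * q * D * (2 * real h) \<le> (q\<^sup>2 + D\<^sup>2) * (2 * real h)"
    using sum_squares_bound[of q D] by (intro mult_right_mono) auto
  also have "\<dots> \<le> q\<^sup>2 * real n + D\<^sup>2 * (2 * real h)"
    using h_less by (simp add: distrib_right mult_left_mono)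
  also have "real n * q\<^sup>2 + (q\<^sup>2 * real n + D\<^sup>2 * (2 * real h)) + D\<^sup>2 * (2 * real h) =
      2 * real n * q\<^sup>2 + 4 * real h * D\<^sup>2" by simp
  also have "\<dots> \<le> 2 * real n * (4 * real h / real n)\<^sup>2 + 4 * real h * (1 - \<beta>)\<^sup>2"
    using q_nonneg q_le D_nonneg D_le by (intro add_mono mult_left_mono power_mono) auto
  also have "2 * real n * (4 * real h / real n)\<^sup>2 = 32 * (real h)\<^sup>2 / real n"
    using n_ge by (simp add: power2_eq_square field_simps)
  finally show ?thesis by simp
qed

text \<open>The overlaps differ by at least \<open>(h - 1 + g) - (h + 2) = g - 3\<close>, weighted
  by \<open>D^2\<close>. Only the pair \<open>i\<close>, \<open>j\<close> carries the
  \<open>of_bool\<close> correction, which costs at most \<open>2 * D\<close> because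
  \<open>q \<le> 1\<close>.\<close>

lemma mean_inner_gap:
  assumes "i < n" "j < n" "j' < n" "j \<in> N i" "ring_dist n (pos i) (pos j) \<le> int h - int g"
    "j' \<noteq> i" "j' \<notin> N i"
  shows "mean_inner i j' + D * (D * (real g - 3) - 2) \<le> mean_inner i j"
proof -
  have ne: "i \<noteq> j" using assms by (auto simp: mem_N)
  have "int h < ring_dist n (pos i) (pos j')" using assms by (auto simp: mem_N)
  then have "real (card (N i \<inter> N j')) + (real g - 3) \<le> real (card (N i \<inter> N j))"
    using overlap_inside[OF assms(1,2,5)] overlap_outside[OF assms(1,3)] by linarith
  then have "D\<^sup>2 * (real (card (N i \<inter> N j')) + (real g - 3)) \<le> D\<^sup>2 * real (card (N i \<inter> N j))"
    by (intro mult_left_mono) auto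
  moreover have "q * D \<le> 1 * D" using q_le' D_nonneg by (intro mult_right_mono) auto
  ultimately show ?thesis
    using mean_inner_eq[OF assms(1,2) ne] mean_inner_eq[OF assms(1,3)] assms
    by (simp add: algebra_simps power2_eq_square)
qed

section \<open>Error of the thresholding and union bound\<close>

lemma corr_thresholding_error:
  assumes i: "i < n" and close: "\<And>j. j < n \<Longrightarrow> j \<noteq> i \<Longrightarrow> \<bar>row_inner n A i j - mean_inner i j\<bar> < s"
    and gap: "2 * s \<le> D * (D * (real g - 3) - 2)"
    and S: "corr_thresholding n (2 * h) A i S"
  shows "card (sym_diff S (N i)) \<le> 4 * g"
proof -
  obtain js where js: "distinct js" "set js = {..<n} - {i}"
      "sorted_wrt (\<lambda>j j'. row_inner n A i j' \<le> row_inner n A i j) js" "S = set (take (2 * h) js)"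
    using S unfolding corr_thresholding_def by blast
  have len: "length js = n - 1" using js i distinct_card[of js] by simp
  \<comment> \<open>The core \<open>C\<close> is far enough inside the neighbourhood to win against
    every outside node: the gap of the means covers two deviations of less than \<open>s\<close>
    each.\<close>
  define C where "C = {l \<in> N i. ring_dist n (pos i) (pos l) \<le> int h - int g}"
  have C: "C \<subseteq> N i" by (auto simp: C_def)
  have "C \<subseteq> set (take (card (N i)) js)"
  proof (rule take_top_contains[OF js(1,3) _ C])
    show "card (N i) \<le> length js" using card_N[OF i] len h_less by simp
    show "C \<subseteq> set js" using C N_subset[of i] js(2) by auto
    show "row_inner n A i j' < row_inner n A i j" if "j \<in> C" "j' \<in> set js - N i" for j j'
    proof -
      have j: "j \<in> N i" "ring_dist n (pos i) (pos j) \<le> int h - int g" "j < n" "j \<noteq> i"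
        using that by (auto simp: C_def mem_N)
      have j': "j' < n" "j' \<noteq> i" "j' \<notin> N i" using that js(2) by auto
      show ?thesis
        using mean_inner_gap[OF i j(3) j'(1) j(1,2) j'(2,3)] close[OF j(3,4)] close[OF j'(1,2)] gap
        by linarith
    qed
  qed simp
  then have CS: "C \<subseteq> S" using js(4) card_N[OF i] by simp
  have card_S: "card S = card (N i)"
    using js(1,4) len h_less card_N[OF i] by (simp add: distinct_card)
  have "card (N i - C) \<le> 2 * g"
  proof (cases "g \<le> h")
    case True
    then have "C = {l \<in> N i. ring_dist n (pos i) (pos l) \<le> int (h - g)}"
      by (simp add: C_def of_nat_diff)
    then have "card C = 2 * (h - g)" using card_N_near[OF i] by simp
    then show ?thesis using C card_N[OF i] True by (simp add: card_Diff_subset finite_subset[OF C])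
  next
    \<comment> \<open>Here \<open>2 * g\<close> exceeds the size of the whole neighbourhood.\<close>
    case False
    then show ?thesis using card_N[OF i] card_mono[of "N i" "N i - C"] by simp
  qed
  moreover have "card (sym_diff S (N i)) \<le> 2 * card (N i - C)"
    using js(4) by (intro card_sym_diff_le card_S C CS) auto
  ultimately show ?thesis by simp
qed

text \<open>\<open>N_hat\<close> is quantified inside the event, so the bound covers every way of
  breaking ties, including one that depends on \<open>A\<close>.\<close>

definition success :: "real \<Rightarrow> matrix set" where
  "success \<epsilon> = {A. \<forall>N_hat. (\<forall>i<n. corr_thresholding n (2 * h) A i (N_hat i)) \<longrightarrow>
    (MAX i\<in>{..<n}. real (card (sym_diff (N_hat i) (N i))) / real (card (N i))) \<le> \<epsilon>}"

text \<open>Union bound over at most \<open>n^2\<close> ordered pairs. Outside the bad events each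
  symmetric difference has at most \<open>4 g\<close> elements, against \<open>2 h\<close>
  neighbours.\<close>

lemma prob_success:
  assumes c: "0 < c" "4 * c \<le> s" "16 * (32 * (real h)\<^sup>2 / real n + 4 * real h * (1 - \<beta>)\<^sup>2) * c \<le> s\<^sup>2"
    and gap: "2 * s \<le> D * (D * (real g - 3) - 2)"
  shows "1 - 2 * (real n)\<^sup>2 * exp (- 3 * c) \<le> measure_pmf.prob G (success (2 * real g / real h))"
proof -
  define J where "J = {(i, j). i < n \<and> j < n \<and> i \<noteq> j}"
  define bad where "bad = (\<lambda>(i, j). {A. s \<le> \<bar>row_inner n A i j - mean_inner i j\<bar>})"
  have J_sub: "J \<subseteq> {..<n} \<times> {..<n}" by (auto simp: J_def)
  have finJ: "finite J" by (rule finite_subset[OF J_sub]) simp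
  have "card J \<le> card ({..<n} \<times> {..<n})" using J_sub by (intro card_mono) auto
  then have cardJ: "real (card J) \<le> (real n)\<^sup>2"
    by (simp add: card_cartesian_product power2_eq_square flip: of_nat_mult)
  have good: "- (\<Union>x\<in>J. bad x) \<subseteq> success (2 * real g / real h)"
  proof
    fix A assume A: "A \<in> - (\<Union>x\<in>J. bad x)"
    have *: "real (card (sym_diff S (N i))) / real (card (N i)) \<le> 2 * real g / real h"
      if "i < n" "corr_thresholding n (2 * h) A i S" for i S
    proof -
      have "card (sym_diff S (N i)) \<le> 4 * g"
      proof (rule corr_thresholding_error[OF that(1) _ gap that(2)])
        fix j assume "j < n" "j \<noteq> i"
        then have "(i, j) \<in> J" using that by (simp add: J_def)
        then have "A \<notin> bad (i, j)" using A by blast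
        then show "\<bar>row_inner n A i j - mean_inner i j\<bar> < s" by (simp add: bad_def)
      qed
      then show ?thesis using h_pos card_N[OF that(1)] by (simp add: field_simps)
    qed
    show "A \<in> success (2 * real g / real h)"
      unfolding success_def using n_ge by (auto intro!: * simp: lessThan_empty_iff)
  qed
  have "measure_pmf.prob G (\<Union>x\<in>J. bad x) \<le> (\<Sum>x\<in>J. measure_pmf.prob G (bad x))"
    using finJ by (intro measure_pmf.finite_measure_subadditive_finite) auto
  also have "\<dots> \<le> (\<Sum>x\<in>J. 2 * exp (- 3 * c))"
  proof (rule sum_mono)
    fix x assume "x \<in> J"
    then obtain i j where x: "x = (i, j)" "i < n" "j < n" "i \<noteq> j" by (auto simp: J_def)
    then show "measure_pmf.prob G (bad x) \<le> 2 * exp (- 3 * c)"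
      using row_inner_concentration[OF x(2-4) c(1,2) mean_inner_le[OF x(2-4)] c(3)]
      by (simp add: bad_def)
  qed
  also have "\<dots> \<le> 2 * (real n)\<^sup>2 * exp (- 3 * c)"
    using cardJ by simp
  finally have "1 - 2 * (real n)\<^sup>2 * exp (- 3 * c) \<le> 1 - measure_pmf.prob G (\<Union>x\<in>J. bad x)" by simp
  also have "\<dots> = measure_pmf.prob G (- (\<Union>x\<in>J. bad x))"
    using measure_pmf.prob_compl[of "\<Union>x\<in>J. bad x" G] by (simp add: Compl_eq_Diff_UNIV)
  also have "\<dots> \<le> measure_pmf.prob G (success (2 * real g / real h))"
    using good by (intro measure_pmf.finite_measure_mono) auto
  finally show ?thesis .
qed

text \<open>In the bound on \<open>g\<close>, the square root makes \<open>D (g - 3) \<ge> 4\<close>, which absorbs the correction \<open>2 q D\<close>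
  of the means, and the term with \<open>r\<close> makes the remaining gap exceed \<open>2 s\<close>.\<close>

lemma prob_success_signal:
  assumes r: "0 \<le> r" "r \<le> 1"
    and signal_k: "sqrt (ln (real n) / real (2 * h)) \<le> r * (1 - \<beta>)"
    and signal_n: "(ln (real n) / real n) powr (1 / 4) \<le> r * (1 - \<beta>)"
    and g: "3 + 1664 * r * real h + 16 * sqrt (2 * real h) \<le> real g"
  shows "1 - 2 / real n \<le> measure_pmf.prob G (success (2 * real g / real h))"
proof -
  define a where "a = 1 - \<beta>"
  define c where "c = ln (real n)"
  have a: "0 \<le> a" using \<beta>_le by (simp add: a_def)
  have "exp 1 \<le> real n" using exp_le n_ge by linarith
  then have c1: "1 \<le> c" using n_ge by (simp add: c_def ln_ge_iff)
  have h: "1 \<le> real h" using h_pos by simp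
  have "(sqrt (c / real (2 * h)))\<^sup>2 \<le> (r * a)\<^sup>2"
    using signal_k c1 unfolding c_def a_def by (intro power_mono) auto
  then have c_k: "c \<le> 2 * real h * (r\<^sup>2 * a\<^sup>2)"
    using c1 h by (simp add: field_simps power_mult_distrib)
  have "((c / real n) powr (1 / 4)) ^ 4 \<le> (r * a) ^ 4"
    using signal_n unfolding c_def a_def by (intro power_mono) auto
  also have "((c / real n) powr (1 / 4)) ^ 4 = c / real n"
    using c1 n_ge by (simp add: powr_power)
  finally have c_n: "c / real n \<le> r ^ 4 * a ^ 4" by (simp add: power_mult_distrib)
  \<comment> \<open>As \<open>r \<le> 1\<close>, powers of \<open>r\<close> can be lowered: to
    \<open>r\<close> so that \<open>s\<close> dominates \<open>4 * c\<close>, and to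
    \<open>r^2\<close> so that both terms of the variance bound are comparable to
    \<open>s^2\<close>.\<close>
  have r_pow: "r\<^sup>2 \<le> r" "r ^ 4 \<le> r\<^sup>2"
    using r power_decreasing[of 1 2 r] power_decreasing[of 2 4 r] by simp_all
  \<comment> \<open>The coefficients of the variance bound add up to \<open>32 + 8 = 40\<close>, and
    26 is the least integer whose square is at least \<open>16 * 40\<close>.\<close>
  define s where "s = 26 * r * a\<^sup>2 * real h"
  have "8 * real h * (r\<^sup>2 * a\<^sup>2) \<le> 26 * real h * (r * a\<^sup>2)"
    using r_pow r h by (intro mult_mono) auto
  then have s1: "4 * c \<le> s" using c_k by (simp add: s_def mult_ac)
  have "(32 * (real h)\<^sup>2 / real n + 4 * real h * a\<^sup>2) * c =
      32 * (real h)\<^sup>2 * (c / real n) + 4 * real h * a\<^sup>2 * c"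
    by (simp add: algebra_simps)
  also have "\<dots> \<le> 32 * (real h)\<^sup>2 * (r\<^sup>2 * a ^ 4) + 4 * real h * a\<^sup>2 * (2 * real h * (r\<^sup>2 * a\<^sup>2))"
    using c_k order_trans[OF c_n mult_right_mono[OF r_pow(2)]] a
    by (intro add_mono mult_left_mono) auto
  also have "\<dots> = 40 * (r\<^sup>2 * a ^ 4 * (real h)\<^sup>2)"
    by (simp add: power2_eq_square power4_eq_xxxx algebra_simps)
  finally have "16 * (32 * (real h)\<^sup>2 / real n + 4 * real h * a\<^sup>2) * c \<le> 640 * (r\<^sup>2 * a ^ 4 * (real h)\<^sup>2)"
    by linarith
  also have "\<dots> \<le> 676 * (r\<^sup>2 * a ^ 4 * (real h)\<^sup>2)" by (intro mult_right_mono) auto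
  also have "\<dots> = s\<^sup>2" by (simp add: s_def power2_eq_square power4_eq_xxxx)
  finally have s2: "16 * (32 * (real h)\<^sup>2 / real n + 4 * real h * a\<^sup>2) * c \<le> s\<^sup>2" .
  have Da: "a / 4 \<le> D" using D_ge by (simp add: a_def)
  have rh: "0 \<le> 1664 * r * real h" "0 \<le> sqrt (2 * real h)" using r by simp_all
  then have g3: "0 \<le> real g - 3" using g by linarith
  have rh_g: "1664 * r * real h \<le> real g - 3" using g rh by linarith
  have sqrt_g: "16 * sqrt (2 * real h) \<le> real g - 3" using g rh by linarith
  \<comment> \<open>Since \<open>1 \<le> c\<close> and \<open>r \<le> 1\<close>, the first signal
    condition forces \<open>1 \<le> a * sqrt (2 h)\<close>. The 16 in the bound on \<open>g\<close>
    is the 4 lost in \<open>a / 4 \<le> D\<close> times the 4 wanted in \<open>D4\<close>.\<close>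
  have "1 / sqrt (2 * real h) \<le> sqrt (c / real (2 * h))"
    using c1 h by (simp add: real_sqrt_divide divide_right_mono)
  also have "\<dots> \<le> r * a" using signal_k by (simp add: c_def a_def)
  also have "\<dots> \<le> 1 * a" using r a by (intro mult_right_mono) auto
  finally have "1 \<le> a * sqrt (2 * real h)" using h by (simp add: field_simps)
  also have "\<dots> \<le> a * ((real g - 3) / 16)"
    by (intro mult_left_mono[OF _ a]) (use sqrt_g in simp)
  also have "\<dots> = (a / 4) * (real g - 3) / 4" by simp
  also have "\<dots> \<le> D * (real g - 3) / 4"
    using Da g3 by (intro divide_right_mono mult_right_mono) auto
  finally have D4: "4 \<le> D * (real g - 3)" by simp
  \<comment> \<open>Half of \<open>D^2 * (g - 3)\<close> pays for \<open>2 * s = 52 r a^2 h\<close>.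
    As \<open>D^2 / 2\<close> is at least \<open>a^2 / 32\<close>, this takes
    \<open>32 * 52 = 1664\<close>.\<close>
  have "2 * s = (a / 4)\<^sup>2 / 2 * (1664 * r * real h)"
    by (simp add: s_def power2_eq_square)
  also have "\<dots> \<le> (a / 4)\<^sup>2 / 2 * (real g - 3)"
    using rh_g by (intro mult_left_mono) auto
  also have "\<dots> \<le> D\<^sup>2 / 2 * (real g - 3)"
    using Da a g3 by (intro mult_right_mono divide_right_mono power_mono) auto
  also have "\<dots> = D * (D * (real g - 3) / 2)" by (simp add: power2_eq_square)
  also have "\<dots> \<le> D * (D * (real g - 3) - 2)"
    using D4 D_nonneg by (intro mult_left_mono) auto
  finally have gap: "2 * s \<le> D * (D * (real g - 3) - 2)" .
  have "exp (- 3 * c) = 1 / real n ^ 3"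
    using n_ge exp_of_nat_mult[of 3 c] by (simp add: c_def exp_minus field_simps)
  then have "2 * (real n)\<^sup>2 * exp (- 3 * c) = 2 / real n"
    using n_ge by (simp add: power2_eq_square power3_eq_cube)
  then show ?thesis
    using prob_success[OF _ s1 s2[unfolded a_def] gap] c1 by simp
qed

end

section \<open>Passage to the limit\<close>

lemma dominates_tendsto_0:
  assumes "dominates a b" "\<forall>\<^sub>F n in sequentially. 0 \<le> a n" "\<And>n. 0 \<le> b n"
  shows "(\<lambda>n. b n / a n) \<longlonglongrightarrow> 0"
proof (rule order_tendstoI)
  \<comment> \<open>A vanishing limsup bounds the quotient only from above; the lower bound comes
    from the signs of \<open>a\<close> and \<open>b\<close>.\<close>
  fix e :: real assume "e < 0"
  show "\<forall>\<^sub>F n in sequentially. e < b n / a n"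
    using assms(2) by eventually_elim (use \<open>e < 0\<close> assms(3) in \<open>simp add: less_le_trans\<close>)
next
  fix e :: real assume "0 < e"
  then have "limsup (\<lambda>n. ereal (b n / a n)) < ereal e"
    using assms(1) by (simp add: dominates_def)
  then show "\<forall>\<^sub>F n in sequentially. b n / a n < e"
    using Limsup_lessD by fastforce
qed

theorem lemma3:
  fixes k :: "nat \<Rightarrow> nat" and \<beta> :: "nat \<Rightarrow> real" and \<pi> :: "nat \<Rightarrow> nat \<Rightarrow> nat"
  assumes k_even: "\<forall>\<^sub>F n in sequentially. even (k n)"
    and k_range: "\<forall>\<^sub>F n in sequentially. 3 * k n \<le> 2 * n"
    and k_lim: "filterlim k at_top sequentially"
    and \<beta>_range: "\<forall>\<^sub>F n in sequentially. 0 \<le> \<beta> n \<and> \<beta> n \<le> 1"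
    and \<pi>_perm: "\<forall>\<^sub>F n in sequentially. \<pi> n permutes {..<n}"
    and signal: "dominates (\<lambda>n. 1 - \<beta> n)
      (\<lambda>n. max (sqrt (ln (real n) / real (k n))) ((ln (real n) / real n) powr (1 / 4)))"
  shows "\<exists>\<epsilon> :: nat \<Rightarrow> real. \<epsilon> \<longlonglongrightarrow> 0 \<and>
    (\<lambda>n. measure_pmf.prob (watts_strogatz n (k n) (\<beta> n) (\<pi> n))
       {A. \<forall>N_hat :: nat \<Rightarrow> nat set.
             (\<forall>i<n. corr_thresholding n (k n) A i (N_hat i)) \<longrightarrow>
             (MAX i\<in>{..<n}. real (card (sym_diff (N_hat i) (true_nbhd n (k n) (\<pi> n) i)))
                / real (card (true_nbhd n (k n) (\<pi> n) i))) \<le> \<epsilon> n}) \<longlonglongrightarrow> 1"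
proof -
  define h where "h n = k n div 2" for n
  define b where "b n = max (sqrt (ln (real n) / real (k n))) ((ln (real n) / real n) powr (1 / 4))" for n
  \<comment> \<open>The ratio of the two sides of the signal condition; \<open>g\<close> below is
    the least natural number that \<open>prob_success_signal\<close> admits for it.\<close>
  define r where "r n = b n / (1 - \<beta> n)" for n
  define g where "g n = nat \<lceil>3 + 1664 * r n * real (h n) + 16 * sqrt (2 * real (h n))\<rceil>" for n
  define \<epsilon> where "\<epsilon> n = 2 * real (g n) / real (h n)" for n
  have b_nonneg: "0 \<le> b n" for n by (simp add: b_def le_max_iff_disj)
  \<comment> \<open>\<open>dominates\<close> makes \<open>1 - \<beta> n\<close> nonzero for large
    \<open>n\<close>, and \<open>\<beta> n \<le> 1\<close> fixes its sign.\<close>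
  have ev_a: "\<forall>\<^sub>F n in sequentially. 0 < 1 - \<beta> n"
    using \<beta>_range signal[unfolded dominates_def, THEN conjunct1]
    by eventually_elim auto
  have r_lim: "r \<longlonglongrightarrow> 0"
    unfolding r_def
    using signal eventually_mono[OF ev_a less_imp_le] b_nonneg
    by (intro dominates_tendsto_0) (auto simp: b_def)
  have r_nonneg: "\<forall>\<^sub>F n in sequentially. 0 \<le> r n"
    using ev_a by eventually_elim (simp add: r_def b_nonneg)
  have h_lim: "filterlim h at_top sequentially"
    unfolding filterlim_at_top
  proof
    fix m
    have "\<forall>\<^sub>F n in sequentially. 2 * m \<le> k n"
      using k_lim by (simp add: filterlim_at_top)
    then show "\<forall>\<^sub>F n in sequentially. m \<le> h n"
      by eventually_elim (simp add: h_def)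
  qed
  have h_pos: "\<forall>\<^sub>F n in sequentially. 0 < h n"
    using filterlim_at_top[THEN iffD1, OF h_lim, rule_format, of 1]
    by eventually_elim simp
  have h_real: "filterlim (\<lambda>n. real (h n)) at_top sequentially"
    using h_lim by (rule filterlim_compose[OF filterlim_real_sequentially])

  have "\<epsilon> \<longlonglongrightarrow> 0"
  proof (rule tendsto_sandwich[OF _ _ tendsto_const])
    show "\<forall>\<^sub>F n in sequentially. 0 \<le> \<epsilon> n" by (simp add: \<epsilon>_def)
    \<comment> \<open>The ceiling in \<open>g\<close> adds at most 1, hence
      \<open>8 = 2 * (3 + 1)\<close>. After division by \<open>h\<close> the square root leaves a
      term of order \<open>1 / sqrt h\<close>.\<close>
    show "\<forall>\<^sub>F n in sequentially. \<epsilon> n \<le> 8 / real (h n) + 3328 * r n + 32 * sqrt 2 / sqrt (real (h n))"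
      using h_pos r_nonneg
    proof eventually_elim
      case (elim n)
      have "0 \<le> 3 + 1664 * r n * real (h n) + 16 * sqrt (2 * real (h n))"
        using elim by simp
      then have "real (g n) \<le> 4 + 1664 * r n * real (h n) + 16 * sqrt (2 * real (h n))"
        unfolding g_def by linarith
      then have "\<epsilon> n \<le> 2 * (4 + 1664 * r n * real (h n) + 16 * sqrt (2 * real (h n))) / real (h n)"
        unfolding \<epsilon>_def by (intro divide_right_mono) auto
      also have "\<dots> = 8 / real (h n) + 3328 * r n + 32 * (sqrt (2 * real (h n)) / real (h n))"
        using elim by (simp add: field_simps)
      also have "sqrt (2 * real (h n)) / real (h n) = sqrt 2 / sqrt (real (h n))"
        using elim by (simp add: real_sqrt_mult field_simps)
      finally show ?case by simp
    qed
    have "(\<lambda>n. 8 / real (h n) + 3328 * r n + 32 * sqrt 2 / sqrt (real (h n))) \<longlonglongrightarrow> 0 + 3328 * 0 + 0"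
      by (intro tendsto_intros r_lim tendsto_divide_0[OF tendsto_const]
          filterlim_at_top_imp_at_infinity h_real filterlim_compose[OF sqrt_at_top h_real])
    then show "(\<lambda>n. 8 / real (h n) + 3328 * r n + 32 * sqrt 2 / sqrt (real (h n))) \<longlonglongrightarrow> 0"
      by simp
  qed
  moreover have "(\<lambda>n. measure_pmf.prob (watts_strogatz n (k n) (\<beta> n) (\<pi> n))
       {A. \<forall>N_hat :: nat \<Rightarrow> nat set.
             (\<forall>i<n. corr_thresholding n (k n) A i (N_hat i)) \<longrightarrow>
             (MAX i\<in>{..<n}. real (card (sym_diff (N_hat i) (true_nbhd n (k n) (\<pi> n) i)))
                / real (card (true_nbhd n (k n) (\<pi> n) i))) \<le> \<epsilon> n}) \<longlonglongrightarrow> 1" (is "?p \<longlonglongrightarrow> 1")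
  proof (rule tendsto_sandwich[OF _ _ _ tendsto_const])
    show "\<forall>\<^sub>F n in sequentially. ?p n \<le> 1" by simp
    show "(\<lambda>n. 1 - 2 / real n) \<longlonglongrightarrow> 1" using tendsto_diff[OF tendsto_const lim_const_over_n[of 2]] by simp
    have "\<forall>\<^sub>F n in sequentially. r n < 1" using r_lim by (rule order_tendstoD) simp
    then show "\<forall>\<^sub>F n in sequentially. 1 - 2 / real n \<le> ?p n"
      using k_even k_range \<beta>_range \<pi>_perm h_pos ev_a r_nonneg eventually_ge_at_top[of 9]
    proof eventually_elim
      case (elim n)
      have k: "k n = 2 * h n" using elim by (simp add: h_def)
      interpret small_world n "h n" "\<beta> n" "\<pi> n"
        by unfold_locales (use elim k in auto)
      \<comment> \<open>The maximum \<open>b n\<close> bounds both of its arguments, so this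
        equation supplies both signal conditions.\<close>
      have "b n = r n * (1 - \<beta> n)" using elim by (simp add: r_def)
      then have "1 - 2 / real n \<le> measure_pmf.prob G (success (2 * real (g n) / real (h n)))"
        using elim by (intro prob_success_signal[of "r n"])
          (auto simp: b_def k g_def max_def split: if_splits intro: real_nat_ceiling_ge)
      then show ?case unfolding success_def k \<epsilon>_def .
    qed
  qed
  ultimately show ?thesis by blast
qed

end
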